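(* Let $n\ge 2$ be an integer, $k,c_b>0$, $\rho_0>0$, and let $\lambda_{1,0},\dots,\lambda_{n,0}$ be real numbers with $\lambda_{1,0}=\cdots=\lambda_{J,0}<\lambda_{J+1,0}\le\cdots\le\lambda_{n,0}$ for some integer $1\le J\le n$. Consider the system $$\lambda_i'=-\lambda_i^2+\frac{k}{n}(\rho-c_b)\ (i=1,\dots,n),\qquad \rho'=-\rho\lambda,\quad \lambda=\sum_{i=1}^n\lambda_i,\qquad \rho(0)=\rho_0,\ \lambda_i(0)=\lambda_{i,0},$$ and suppose its maximal interval of existence is $[0,t_B)$ with $0<t_B<\infty$. Then $1\le J<n$, $\lim_{t\to t_B^-}\lambda_i(t)=-\infty$ for $1\le i\le J$, and $\lim_{t\to t_B^-}\lambda_i(t)=+\infty$ for $J<i\le n$.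
   Context: Solutions are real-valued and continuously differentiable on $[0,t_B)$. *)

theory Defs
  imports "HOL-Analysis.Analysis"
begin

definition is_solution ::
  "nat \<Rightarrow> real \<Rightarrow> real \<Rightarrow> real \<Rightarrow> (nat \<Rightarrow> real) \<Rightarrow> real
   \<Rightarrow> (nat \<Rightarrow> real \<Rightarrow> real) \<Rightarrow> (real \<Rightarrow> real) \<Rightarrow> bool" where
  "is_solution n k cb rho0 lam0 T lam rho \<longleftrightarrow>
     0 < T \<and>
     rho 0 = rho0 \<and> (\<forall>i\<in>{1..n}. lam i 0 = lam0 i) \<and>
     (\<forall>t\<in>{0..<T}.
        (\<forall>i\<in>{1..n}. ((lam i) has_real_derivative
              (- ((lam i t)^2) + k / real n * (rho t - cb))) (at t within {0..<T})) \<and>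
        (rho has_real_derivative (- rho t * (\<Sum>i=1..n. lam i t))) (at t within {0..<T})) \<and>
     (\<forall>i\<in>{1..n}. continuous_on {0..<T} (\<lambda>t. - ((lam i t)^2) + k / real n * (rho t - cb))) \<and>
     continuous_on {0..<T} (\<lambda>t. - rho t * (\<Sum>i=1..n. lam i t))"

definition maximal_solution ::
  "nat \<Rightarrow> real \<Rightarrow> real \<Rightarrow> real \<Rightarrow> (nat \<Rightarrow> real) \<Rightarrow> real
   \<Rightarrow> (nat \<Rightarrow> real \<Rightarrow> real) \<Rightarrow> (real \<Rightarrow> real) \<Rightarrow> bool" where
  "maximal_solution n k cb rho0 lam0 tB lam rho \<longleftrightarrow>
     is_solution n k cb rho0 lam0 tB lam rho \<and>
     \<not> (\<exists>T > tB. \<exists>lam' rho'. is_solution n k cb rho0 lam0 T lam' rho' \<and>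
          (\<forall>t\<in>{0..<tB}. rho' t = rho t \<and> (\<forall>i\<in>{1..n}. lam' i t = lam i t)))"

end

theory Submission
  imports Defs
begin

text \<open>
  Write \<open>a = k / n\<close>. Since \<open>\<rho> > 0\<close>, every \<open>\<lambda>\<^sub>i\<close> satisfies \<open>\<lambda>\<^sub>i' \<ge> - \<lambda>\<^sub>i\<^sup>2 - \<omega>\<^sup>2\<close> with \<open>\<omega>\<^sup>2 = a c\<^sub>b\<close>, so
  \<open>arctan (\<lambda>\<^sub>i / \<omega>) + \<omega> t\<close> is nondecreasing and \<open>\<lambda>\<^sub>i\<close> has a limit in \<open>[-\<infinity>, \<infinity>]\<close> at \<open>t\<^sub>B\<close>.
  With \<open>Y\<^sub>i = exp (\<integral> \<lambda>\<^sub>i)\<close> the system becomes linear, \<open>Y\<^sub>i'' = a (\<rho> - c\<^sub>b) Y\<^sub>i\<close>, with conserved quantities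
  \<open>\<rho> \<Prod>Y\<^sub>i\<close> and the Wronskians \<open>(\<lambda>\<^sub>j - \<lambda>\<^sub>i) Y\<^sub>i Y\<^sub>j\<close>.

  If no \<open>\<lambda>\<^sub>i\<close> tended to \<open>-\<infinity>\<close>, all \<open>Y\<^sub>i\<close> would stay away from \<open>0\<close>, hence \<open>\<rho>\<close> and then all \<open>\<lambda>\<^sub>i\<close> would be
  bounded and the solution could be continued. So the smallest one, \<open>\<lambda>\<^sub>1\<close>, tends to \<open>-\<infinity>\<close>. Whenever
  \<open>\<lambda>\<^sub>i \<rightarrow> -\<infinity>\<close>, \<open>Y\<^sub>i'\<close> is bounded and \<open>Y\<^sub>i = O(t\<^sub>B - t)\<close>; therefore two such indices have Wronskian \<open>0\<close>, that is,
  equal initial values. If some \<open>\<lambda>\<^sub>j\<close> had a finite limit, all \<open>Y\<^sub>m\<close> would be bounded and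
  \<open>\<lambda>\<^sub>j' \<ge> C / (t\<^sub>B - t) - D\<close>, which is not integrable; if all \<open>\<lambda>\<^sub>i\<close> coincided, \<open>Y\<^sub>1'\<close> would satisfy the same
  inequality although \<open>Y\<^sub>1' < 0\<close>.
\<close>

section \<open>Monotonicity and limits on half-open intervals\<close>

lemma at_within_Ico_at:
  fixes t T :: real
  assumes "0 < t" "t < T"
  shows "at t within {0..<T} = at t"
  by (rule at_within_open_subset[where S="{0<..<T}"]) (use assms in auto)

lemma at_left_Ico:
  fixes T :: real
  assumes "a < T" "\<And>t. a \<le> t \<Longrightarrow> t < T \<Longrightarrow> P t"
  shows "eventually P (at_left T)"
  using assms eventually_at_left_real[OF assms(1)] by (auto elim: eventually_mono)

lemma at_left_Ico_obtain:
  fixes T :: real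
  assumes "eventually P (at_left T)" "a < T"
  obtains b where "a \<le> b" "b < T" "\<And>t. b \<le> t \<Longrightarrow> t < T \<Longrightarrow> P t"
proof -
  obtain b where b: "b < T" "\<And>t. b < t \<Longrightarrow> t < T \<Longrightarrow> P t"
    using assms(1) by (auto simp: eventually_at_left[OF assms(2)])
  show ?thesis
    \<comment> \<open>The filter only controls points strictly above \<open>b\<close>; the midpoint
      with \<open>T\<close> gives a start at which the property already holds.\<close>
    by (rule that[of "max a ((b + T) / 2)"]) (use b assms(2) in \<open>auto simp: max_def field_simps split: if_splits\<close>)
qed

text \<open>At interior points the derivative within \<open>{0..<T}\<close> is two-sided, and at the
  end points continuity suffices, so \<open>s = 0\<close> is covered as well.\<close>

lemma nondecreasing_if_deriv_nonneg:
  fixes f f' :: "real \<Rightarrow> real"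
  assumes "\<And>t. a \<le> t \<Longrightarrow> t < T \<Longrightarrow> (f has_real_derivative f' t) (at t within {0..<T})"
    and "\<And>t. a \<le> t \<Longrightarrow> t < T \<Longrightarrow> 0 \<le> f' t"
    and "0 \<le> a" "a \<le> s" "s \<le> t" "t < T"
  shows "f s \<le> f t"
proof (rule DERIV_nonneg_imp_increasing_open[OF \<open>s \<le> t\<close>])
  fix x assume x: "s < x" "x < t"
  then have "(f has_real_derivative f' x) (at x)"
    using assms(1)[of x] assms by (simp add: at_within_Ico_at)
  then show "\<exists>y. (f has_real_derivative y) (at x) \<and> 0 \<le> y"
    using x assms by (intro exI[of _ "f' x"]) auto
next
  have "\<And>x. x \<in> {s..t} \<Longrightarrow> (f has_real_derivative f' x) (at x within {s..t})"
    by (rule DERIV_subset[OF assms(1)]) (use assms in auto)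
  then show "continuous_on {s..t} f"
    by (meson DERIV_continuous_on)
qed

lemma nonincreasing_if_deriv_nonpos:
  fixes f f' :: "real \<Rightarrow> real"
  assumes "\<And>t. a \<le> t \<Longrightarrow> t < T \<Longrightarrow> (f has_real_derivative f' t) (at t within {0..<T})"
    and "\<And>t. a \<le> t \<Longrightarrow> t < T \<Longrightarrow> f' t \<le> 0"
    and "0 \<le> a" "a \<le> s" "s \<le> t" "t < T"
  shows "f t \<le> f s"
  using nondecreasing_if_deriv_nonneg[of a T "\<lambda>x. - f x" "\<lambda>x. - f' x" s t] assms
  by (auto intro!: derivative_eq_intros)

lemma constant_if_deriv_zero:
  fixes f :: "real \<Rightarrow> real"
  assumes "\<And>t. 0 \<le> t \<Longrightarrow> t < T \<Longrightarrow> (f has_real_derivative 0) (at t within {0..<T})"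
    and "0 \<le> t" "t < T"
  shows "f t = f 0"
  using nondecreasing_if_deriv_nonneg[of 0 T f "\<lambda>_. 0" 0 t]
    nonincreasing_if_deriv_nonpos[of 0 T f "\<lambda>_. 0" 0 t] assms by (auto intro: order_antisym)

lemma bounded_nondecreasing_tendsto_left:
  fixes f :: "real \<Rightarrow> real"
  assumes "\<And>s t. a \<le> s \<Longrightarrow> s \<le> t \<Longrightarrow> t < T \<Longrightarrow> f s \<le> f t"
    and "\<And>t. a \<le> t \<Longrightarrow> t < T \<Longrightarrow> f t \<le> B" and "a < T"
  obtains L where "(f \<longlongrightarrow> L) (at_left T)"
proof -
  define L where "L = (SUP t\<in>{a..<T}. f t)"
  have bdd: "bdd_above (f ` {a..<T})"
    using assms(2) by (auto intro!: bdd_aboveI[of _ B])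
  have "(f \<longlongrightarrow> L) (at_left T)"
  proof (rule order_tendstoI)
    fix c assume "c < L"
    then obtain s where s: "s \<in> {a..<T}" "c < f s"
      using less_cSUP_iff[of "{a..<T}" f c] bdd assms(3) by (auto simp: L_def)
    show "eventually (\<lambda>t. c < f t) (at_left T)"
      by (rule at_left_Ico[of s]) (use s assms(1) in \<open>auto intro: less_le_trans\<close>)
  next
    fix c assume "L < c"
    show "eventually (\<lambda>t. f t < c) (at_left T)"
    proof (rule at_left_Ico[of a])
      fix t assume "a \<le> t" "t < T"
      then have "f t \<le> L"
        unfolding L_def by (intro cSUP_upper bdd) auto
      then show "f t < c" using \<open>L < c\<close> by simp
    qed fact
  qed
  then show thesis by (rule that)
qed

text \<open>Adding \<open>C * t\<close> makes \<open>f\<close> nondecreasing, and subtracting it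
  gives the upper bound, so monotone convergence applies to \<open>f t + C * t\<close>.\<close>

lemma bounded_deriv_tendsto_left:
  fixes f f' :: "real \<Rightarrow> real"
  assumes der: "\<And>t. 0 \<le> t \<Longrightarrow> t < T \<Longrightarrow> (f has_real_derivative f' t) (at t within {0..<T})"
    and bd: "\<And>t. 0 \<le> t \<Longrightarrow> t < T \<Longrightarrow> \<bar>f' t\<bar> \<le> C"
    and T: "0 < T"
  obtains L where "(f \<longlongrightarrow> L) (at_left T)"
proof -
  have up: "f s + C * s \<le> f t + C * t" if "0 \<le> s" "s \<le> t" "t < T" for s t
    by (rule nondecreasing_if_deriv_nonneg[of 0 T "\<lambda>t. f t + C * t" "\<lambda>t. f' t + C"])
      (use bd that in \<open>force intro!: derivative_eq_intros der\<close>)+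
  have dn: "f t - C * t \<le> f 0 - C * 0" if "0 \<le> t" "t < T" for t
    by (rule nonincreasing_if_deriv_nonpos[of 0 T "\<lambda>t. f t - C * t" "\<lambda>t. f' t - C"])
      (use bd that in \<open>force intro!: derivative_eq_intros der\<close>)+
  have "C \<ge> 0" using bd[of 0] T by auto
  have "f t + C * t \<le> f 0 + 2 * C * T" if "0 \<le> t" "t < T" for t
    using dn[OF that] mult_left_mono[of t T C] that \<open>C \<ge> 0\<close> by auto
  from bounded_nondecreasing_tendsto_left[of 0 T "\<lambda>t. f t + C * t", OF up this T]
  obtain L where "((\<lambda>t. f t + C * t) \<longlongrightarrow> L) (at_left T)" by blast
  then have "((\<lambda>t. (f t + C * t) - C * t) \<longlongrightarrow> L - C * T) (at_left T)"
    by (intro tendsto_intros)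
  then show thesis by (intro that) simp
qed

text \<open>Differentiability at the junction needs no value of \<open>f\<close> at
  \<open>T\<close>: by the rule of l'Hopital the left difference quotient inherits the left limit of
  \<open>f'\<close>, and the right one comes from \<open>g\<close>.\<close>

lemma has_real_derivative_glue:
  fixes f g f' g' :: "real \<Rightarrow> real"
  assumes T: "0 < T" "T < T'"
    and f: "\<And>t. 0 \<le> t \<Longrightarrow> t < T \<Longrightarrow> (f has_real_derivative f' t) (at t within {0..<T})"
    and g: "\<And>t. T \<le> t \<Longrightarrow> t < T' \<Longrightarrow> (g has_real_derivative g' t) (at t)"
    and lim: "(f \<longlongrightarrow> g T) (at_left T)" "(f' \<longlongrightarrow> g' T) (at_left T)"
    and t: "0 \<le> t" "t < T'"
  shows "((\<lambda>t. if t < T then f t else g t) has_real_derivative (if t < T then f' t else g' t))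
    (at t within {0..<T'})"
proof -
  let ?h = "\<lambda>t. if t < T then f t else g t"
  consider "t < T" | "t = T" | "T < t" by linarith
  then show ?thesis
  proof cases
    case 1
    have eq: "at t within {0..<T} = at t within {0..<T'}"
      by (rule at_within_nhd[of _ "{..<T}"]) (use 1 T in auto)
    have "(?h has_real_derivative f' t) (at t within {0..<T})"
      by (rule has_field_derivative_transform_within[OF f, of _ 1]) (use 1 t in auto)
    then show ?thesis using 1 eq by simp
  next
    case 3
    have "(?h has_real_derivative g' t) (at t)"
      by (rule has_field_derivative_transform_within_open[OF g, of _ "{T<..}"]) (use 3 t in auto)
    then show ?thesis using 3 by (simp add: has_field_derivative_at_within)
  next
    case 2
    have "((\<lambda>y. (f y - g T) / (y - T)) \<longlongrightarrow> g' T) (at_left T)"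
    proof (rule lhopital_left[where f' = f' and g' = "\<lambda>_. 1"])
      show "((\<lambda>y. f y - g T) \<longlongrightarrow> 0) (at_left T)"
        using lim(1) by (simp add: LIM_zero)
      show "((\<lambda>y. y - T) \<longlongrightarrow> 0) (at_left T)"
        by (auto intro!: tendsto_eq_intros)
      show "eventually (\<lambda>y. y - T \<noteq> 0) (at_left T)"
        by (rule at_left_Ico[of 0]) (use T in auto)
      show "\<forall>\<^sub>F x in at_left T. ((\<lambda>y. f y - g T) has_real_derivative f' x) (at x)"
        \<comment> \<open>Starting at \<open>T/2\<close> avoids the point \<open>0\<close>, where
          the derivative of \<open>f\<close> is only one-sided.\<close>
        by (rule at_left_Ico[of "T/2"])
          (use T f in \<open>auto intro!: derivative_eq_intros simp flip: at_within_Ico_at[of _ T]\<close>)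
      show "\<forall>\<^sub>F x in at_left T. ((\<lambda>y. y - T) has_real_derivative 1) (at x)"
        by (auto intro!: always_eventually derivative_eq_intros)
    qed (use lim(2) in auto)
    then have left: "((\<lambda>y. (?h y - ?h T) / (y - T)) \<longlongrightarrow> g' T) (at_left T)"
      by (rule Lim_transform_eventually) (rule at_left_Ico[of 0], use T in auto)
    have "((\<lambda>y. (g y - g T) / (y - T)) \<longlongrightarrow> g' T) (at_right T)"
      using g[of T] T by (simp add: has_field_derivative_iff filterlim_at_split)
    then have right: "((\<lambda>y. (?h y - ?h T) / (y - T)) \<longlongrightarrow> g' T) (at_right T)"
      by (rule Lim_transform_eventually) (auto simp: eventually_at_filter)
    from left right have "(?h has_real_derivative g' T) (at T)"
      unfolding has_field_derivative_iff filterlim_at_split by blast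
    then show ?thesis using 2 by (simp add: has_field_derivative_at_within)
  qed
qed

section \<open>Local solutions and continuation\<close>

text \<open>Index \<open>0\<close> stands for \<open>\<rho>\<close>, the indices \<open>1, \<dots>, n\<close> for \<open>\<lambda>\<^sub>1, \<dots>, \<lambda>\<^sub>n\<close>.\<close>

fun taylor_coeff :: "nat \<Rightarrow> real \<Rightarrow> real \<Rightarrow> (nat \<Rightarrow> real) \<Rightarrow> nat \<Rightarrow> nat \<Rightarrow> real" where
  "taylor_coeff n a cb x0 0 i = x0 i"
| "taylor_coeff n a cb x0 (Suc m) i =
    (if i = 0
     then - (\<Sum>j\<in>{0..m}. taylor_coeff n a cb x0 j 0 * (\<Sum>l\<in>{1..n}. taylor_coeff n a cb x0 (m - j) l))
     else - (\<Sum>j\<in>{0..m}. taylor_coeff n a cb x0 j i * taylor_coeff n a cb x0 (m - j) i)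
       + a * (taylor_coeff n a cb x0 m 0 - (if m = 0 then cb else 0))) / real (Suc m)"

declare taylor_coeff.simps [simp del]

text \<open>
  The convolution has \<open>m + 1\<close> terms, each bounded by \<open>A\<^sup>2 R\<^sup>m\<close>; this cancels the denominator \<open>m + 1\<close>, so a
  geometric bound propagates.
\<close>

lemma taylor_coeff_bound:
  assumes A: "A \<ge> 1" "\<And>i. i \<le> n \<Longrightarrow> \<bar>x0 i\<bar> \<le> A" and a: "a \<ge> 0" "cb \<ge> 0"
    and R: "R \<ge> 1" "R \<ge> A + a + a * cb" "R \<ge> real n * A"
    and i: "i \<le> n"
  shows "\<bar>taylor_coeff n a cb x0 m i\<bar> \<le> A * R ^ m"
  using i
proof (induction m arbitrary: i rule: less_induct)
  case (less m)
  show ?case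
  proof (cases m)
    case 0
    then show ?thesis using A less.prems by (simp add: taylor_coeff.simps)
  next
    case (Suc p)
    let ?c = "taylor_coeff n a cb x0"
    have IH: "\<bar>?c j i\<bar> \<le> A * R ^ j" if "j \<le> p" "i \<le> n" for j i
      using less.IH that Suc by auto
    have AR: "0 \<le> A * R ^ j" for j using A R by auto
    have pow: "A * R ^ j * (A * R ^ (p - j)) = A\<^sup>2 * R ^ p" if "j \<le> p" for j
      using that by (simp add: power2_eq_square flip: power_add)
    have Rp: "0 \<le> R ^ p" "1 \<le> R ^ p" using R by (auto simp: one_le_power)
    show ?thesis
    proof (cases "i = 0")
      case True
      have "\<bar>\<Sum>j\<in>{0..p}. ?c j 0 * (\<Sum>l\<in>{1..n}. ?c (p - j) l)\<bar> \<le> (\<Sum>j\<in>{0..p}. real n * (A\<^sup>2 * R ^ p))"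
      proof (rule order.trans[OF sum_abs], rule sum_mono)
        fix j assume j: "j \<in> {0..p}"
        have "\<bar>\<Sum>l\<in>{1..n}. ?c (p - j) l\<bar> \<le> (\<Sum>l\<in>{1..n}. A * R ^ (p - j))"
          by (rule order.trans[OF sum_abs], rule sum_mono) (use IH in auto)
        then have "\<bar>?c j 0\<bar> * \<bar>\<Sum>l\<in>{1..n}. ?c (p - j) l\<bar> \<le> (A * R ^ j) * (real n * (A * R ^ (p - j)))"
          by (intro mult_mono) (use IH j AR in auto)
        also have "\<dots> = real n * (A * R ^ j * (A * R ^ (p - j)))" by (simp only: mult_ac)
        finally show "\<bar>?c j 0 * (\<Sum>l\<in>{1..n}. ?c (p - j) l)\<bar> \<le> real n * (A\<^sup>2 * R ^ p)"
          using pow[of j] j by (simp add: abs_mult)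
      qed
      then have "\<bar>?c m i\<bar> \<le> real n * (A\<^sup>2 * R ^ p)"
        using True Suc by (simp add: taylor_coeff.simps field_simps)
      also have "\<dots> = (real n * A) * (A * R ^ p)" by (simp add: power2_eq_square)
      also have "\<dots> \<le> R * (A * R ^ p)" by (intro mult_right_mono R AR)
      finally show ?thesis using Suc by (simp add: mult_ac)
    next
      case False
      have "\<bar>\<Sum>j\<in>{0..p}. ?c j i * ?c (p - j) i\<bar> \<le> (\<Sum>j\<in>{0..p}. A\<^sup>2 * R ^ p)"
      proof (rule order.trans[OF sum_abs], rule sum_mono)
        fix j assume j: "j \<in> {0..p}"
        have "\<bar>?c j i\<bar> * \<bar>?c (p - j) i\<bar> \<le> (A * R ^ j) * (A * R ^ (p - j))"
          by (intro mult_mono) (use IH j AR less.prems in auto)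
        then show "\<bar>?c j i * ?c (p - j) i\<bar> \<le> A\<^sup>2 * R ^ p"
          using pow[of j] j by (simp add: abs_mult)
      qed
      then have 1: "\<bar>\<Sum>j\<in>{0..p}. ?c j i * ?c (p - j) i\<bar> \<le> real (Suc p) * (A\<^sup>2 * R ^ p)" by simp
      have "\<bar>?c p 0 - (if p = 0 then cb else 0)\<bar> \<le> A * R ^ p + cb"
        using IH[of p 0] a by auto
      then have "\<bar>a * (?c p 0 - (if p = 0 then cb else 0))\<bar> \<le> a * (A * R ^ p + cb)"
        using a by (simp add: abs_mult mult_left_mono)
      \<comment> \<open>Since \<open>A * R ^ p\<close> is at least \<open>1\<close>, the constant
        \<open>cb\<close> is absorbed into the geometric bound.\<close>
      also have "\<dots> \<le> a * (A * R ^ p + cb * (A * R ^ p))"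
      proof -
        have "1 * 1 \<le> A * R ^ p" by (intro mult_mono) (use A Rp in auto)
        then show ?thesis using a by (intro mult_left_mono) (auto simp: mult_le_cancel_left1)
      qed
      \<comment> \<open>The linear term has no factor \<open>p + 1\<close> of its own; inserting one
        lets the division by \<open>p + 1\<close> treat it like the convolution.\<close>
      also have "\<dots> \<le> real (Suc p) * ((a + a * cb) * (A * R ^ p))"
      proof -
        have "0 \<le> (a + a * cb) * (A * R ^ p)" using a by (intro mult_nonneg_nonneg[OF _ AR]) auto
        then show ?thesis
          using mult_right_mono[of 1 "real (Suc p)" "(a + a * cb) * (A * R ^ p)"]
          by (simp add: algebra_simps)
      qed
      finally have 2: "\<bar>a * (?c p 0 - (if p = 0 then cb else 0))\<bar> \<le> real (Suc p) * ((a + a * cb) * (A * R ^ p))" .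
      have "\<bar>?c m i\<bar> * real (Suc p) \<le> real (Suc p) * (A\<^sup>2 * R ^ p) + real (Suc p) * ((a + a * cb) * (A * R ^ p))"
        using False Suc 1 2 unfolding Suc taylor_coeff.simps abs_divide by (simp del: of_nat_Suc sum.atLeast0_atMost_Suc)
      then have "real (Suc p) * \<bar>?c m i\<bar> \<le> real (Suc p) * ((A + a + a * cb) * (A * R ^ p))"
        by (simp add: algebra_simps power2_eq_square)
      then have "\<bar>?c m i\<bar> \<le> (A + a + a * cb) * (A * R ^ p)" by (simp only: mult_le_cancel_left_pos of_nat_0_less_iff zero_less_Suc)
      also have "\<dots> \<le> R * (A * R ^ p)" by (intro mult_right_mono R AR)
      finally show ?thesis using Suc by (simp add: mult_ac)
    qed
  qed
qed

lemma summable_if_geometric_bound: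
  fixes c :: "nat \<Rightarrow> real"
  assumes "\<And>m. \<bar>c m\<bar> \<le> B * R ^ m" "R > 0" "\<bar>t\<bar> \<le> 1 / (2 * R)"
  shows "summable (\<lambda>m. c m * t ^ m)"
proof (rule summable_comparison_test'[where g = "\<lambda>m. B * (1/2) ^ m" and N = 0])
  fix m
  have "\<bar>c m\<bar> * \<bar>t\<bar> ^ m \<le> (B * R ^ m) * (1 / (2 * R)) ^ m"
    by (intro mult_mono power_mono) (use assms order_trans[OF abs_ge_zero assms(1)] in auto)
  also have "\<dots> = B * (1/2) ^ m"
    using assms(2) by (simp add: field_simps)
  finally show "norm (c m * t ^ m) \<le> B * (1/2) ^ m"
    by (simp add: abs_mult power_abs)
qed (auto intro!: summable_mult summable_geometric)

lemma fps_conv_radius_if_geometric_bound: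
  fixes F :: "real fps"
  assumes "\<And>m. \<bar>fps_nth F m\<bar> \<le> B * R ^ m" "R > 0" "\<bar>t\<bar> < 1 / (2 * R)"
  shows "ereal (norm t) < fps_conv_radius F"
proof -
  have "ereal (norm (1 / (2 * R))) \<le> fps_conv_radius F"
    unfolding fps_conv_radius_def
    by (rule conv_radius_geI, rule summable_if_geometric_bound[where c = "fps_nth F", OF assms(1,2)]) (use assms in auto)
  moreover have "ereal (norm t) < ereal (norm (1 / (2 * R)))" using assms by simp
  ultimately show ?thesis by (rule less_le_trans[rotated])
qed

text \<open>The vector field is polynomial, so the solution is built as a power series: the
  recursion for the coefficients is the system read as an identity of formal series, and the
  geometric bound gives convergence. The series also converges for negative \<open>t\<close>, which
  makes the derivative at \<open>0\<close> two-sided.\<close>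

lemma local_solution_exists:
  fixes a cb r0 :: real and l0 :: "nat \<Rightarrow> real"
  assumes a: "a \<ge> 0" "cb \<ge> 0"
  obtains h rho lam where "h > 0" "rho 0 = r0" "\<And>i. i \<in> {1..n} \<Longrightarrow> lam i 0 = l0 i"
    "\<And>t i. \<bar>t\<bar> < h \<Longrightarrow> i \<in> {1..n} \<Longrightarrow>
      (lam i has_real_derivative - (lam i t)\<^sup>2 + a * (rho t - cb)) (at t)"
    "\<And>t. \<bar>t\<bar> < h \<Longrightarrow> (rho has_real_derivative - rho t * (\<Sum>i=1..n. lam i t)) (at t)"
proof -
  define x0 where "x0 = (\<lambda>i. if i = 0 then r0 else l0 i)"
  define c where "c = taylor_coeff n a cb x0"
  define F where "F = (\<lambda>i. Abs_fps (\<lambda>m. c m i))"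
  \<comment> \<open>\<open>G\<close> is the series of the sum of all \<open>lam i\<close>, so that
    the equation for \<open>rho\<close> becomes a single Cauchy product.\<close>
  define G where "G = Abs_fps (\<lambda>m. \<Sum>l\<in>{1..n}. c m l)"
  define A where "A = 1 + (\<Sum>i\<le>n. \<bar>x0 i\<bar>)"
  \<comment> \<open>All summands are nonnegative, so \<open>R\<close> dominates each of the three
    lower bounds required by the coefficient estimate.\<close>
  define R where "R = 1 + (A + a + a * cb) + real n * A"
  define X where "X = (\<lambda>i. eval_fps (F i))"
  have A: "A \<ge> 1" "\<And>i. i \<le> n \<Longrightarrow> \<bar>x0 i\<bar> \<le> A"
    unfolding A_def by (auto simp: sum_nonneg intro!: order.trans[OF member_le_sum[of _ "{..n}" "\<lambda>i. \<bar>x0 i\<bar>"]])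
  have R: "R \<ge> 1" "R \<ge> A + a + a * cb" "R \<ge> real n * A" "R > 0"
    unfolding R_def using A a by (auto intro!: add_nonneg_nonneg add_pos_nonneg)
  have cb: "\<bar>c m i\<bar> \<le> A * R ^ m" if "i \<le> n" for m i
    unfolding c_def by (rule taylor_coeff_bound) (use A a R that in auto)
  have Gb: "\<bar>fps_nth G m\<bar> \<le> (real n * A) * R ^ m" for m
  proof -
    have "\<bar>\<Sum>l\<in>{1..n}. c m l\<bar> \<le> (\<Sum>l\<in>{1..n}. A * R ^ m)"
      by (rule order.trans[OF sum_abs], rule sum_mono) (use cb in auto)
    then show ?thesis by (simp add: G_def)
  qed
  define h where "h = 1 / (2 * R)"
  have radF: "ereal (norm t) < fps_conv_radius (F i)" if "\<bar>t\<bar> < h" "i \<le> n" for t i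
    by (rule fps_conv_radius_if_geometric_bound[of _ A R]) (use cb R that in \<open>auto simp: F_def h_def\<close>)
  have radG: "ereal (norm t) < fps_conv_radius G" if "\<bar>t\<bar> < h" for t
    by (rule fps_conv_radius_if_geometric_bound[OF Gb]) (use R that in \<open>auto simp: h_def\<close>)
  have evG: "eval_fps G t = (\<Sum>l\<in>{1..n}. X l t)" if "\<bar>t\<bar> < h" for t
  proof -
    have sm: "summable (\<lambda>m. c m l * t ^ m)" if "l \<in> {1..n}" for l
      by (rule summable_if_geometric_bound[of _ A R]) (use cb R that \<open>\<bar>t\<bar> < h\<close> in \<open>auto simp: h_def\<close>)
    show ?thesis
      using suminf_sum[of "{1..n}" "\<lambda>l m. c m l * t ^ m", OF sm]
      by (simp add: X_def F_def G_def eval_fps_def sum_distrib_right del: One_nat_def)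
  qed
  have nth: "fps_nth (F i) m = taylor_coeff n a cb x0 m i" for i m
    by (simp add: F_def c_def)
  have dF: "fps_deriv (F i) = - (F i * F i) + fps_const a * (F 0 - fps_const cb)" if "i \<noteq> 0" for i
  proof (rule fps_ext)
    fix m
    show "fps_nth (fps_deriv (F i)) m = fps_nth (- (F i * F i) + fps_const a * (F 0 - fps_const cb)) m"
      using that by (simp add: nth taylor_coeff.simps(2) fps_mult_nth[of "F i" "F i"])
  qed
  have d0: "fps_deriv (F 0) = - (F 0 * G)"
  proof (rule fps_ext)
    fix m
    show "fps_nth (fps_deriv (F 0)) m = fps_nth (- (F 0 * G)) m"
      by (simp add: F_def G_def c_def taylor_coeff.simps(2) fps_mult_nth)
  qed
  show thesis
  proof (rule that[of h "X 0" X])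
    show "h > 0" using R by (simp add: h_def)
    show "X 0 0 = r0"
      by (simp add: X_def eval_fps_at_0 F_def c_def taylor_coeff.simps x0_def)
    show "X i 0 = l0 i" if "i \<in> {1..n}" for i
      using that by (simp add: X_def eval_fps_at_0 F_def c_def taylor_coeff.simps x0_def)
  next
    fix t i assume t: "\<bar>t\<bar> < h" and i: "i \<in> {1..n}"
    have r: "ereal (norm t) < fps_conv_radius (F i)" "ereal (norm t) < fps_conv_radius (F 0)"
      using radF t i by auto
    have r': "ereal (norm t) < fps_conv_radius (F i * F i)"
      using less_le_trans[OF _ fps_conv_radius_mult[of "F i" "F i"]] r by simp
    have r'': "ereal (norm t) < fps_conv_radius (F 0 - fps_const cb)"
      using less_le_trans[OF _ fps_conv_radius_diff[of "F 0" "fps_const cb"]] r by simp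
    have r3: "ereal (norm t) < fps_conv_radius (fps_const a * (F 0 - fps_const cb))"
      using less_le_trans[OF _ fps_conv_radius_mult[of "fps_const a" "F 0 - fps_const cb"]] r'' by simp
    have "eval_fps (fps_deriv (F i)) t = - (X i t)\<^sup>2 + a * (X 0 t - cb)"
      using i r r' r'' r3 by (simp add: dF X_def eval_fps_add eval_fps_minus eval_fps_mult eval_fps_diff power2_eq_square)
    then show "(X i has_real_derivative - (X i t)\<^sup>2 + a * (X 0 t - cb)) (at t)"
      using has_field_derivative_eval_fps[OF r(1), of UNIV] by (simp add: X_def)
  next
    fix t assume t: "\<bar>t\<bar> < h"
    have r: "ereal (norm t) < fps_conv_radius (F 0)" "ereal (norm t) < fps_conv_radius G"
      using radF radG t by auto
    have r': "ereal (norm t) < fps_conv_radius (F 0 * G)"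
      using less_le_trans[OF _ fps_conv_radius_mult[of "F 0" G]] r by simp
    have "eval_fps (fps_deriv (F 0)) t = - X 0 t * (\<Sum>i=1..n. X i t)"
      using r r' by (simp add: d0 X_def eval_fps_minus eval_fps_mult evG[OF t])
    then show "(X 0 has_real_derivative - X 0 t * (\<Sum>i=1..n. X i t)) (at t)"
      using has_field_derivative_eval_fps[OF r(1), of UNIV] by (simp add: X_def)
  qed
qed

section \<open>Continuation of bounded solutions\<close>

lemma is_solutionI:
  assumes "0 < T" "rho 0 = rho0" "\<And>i. i \<in> {1..n} \<Longrightarrow> lam i 0 = lam0 i"
    and lam: "\<And>t i. 0 \<le> t \<Longrightarrow> t < T \<Longrightarrow> i \<in> {1..n} \<Longrightarrow>
      (lam i has_real_derivative - (lam i t)\<^sup>2 + k / real n * (rho t - cb)) (at t within {0..<T})"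
    and rho: "\<And>t. 0 \<le> t \<Longrightarrow> t < T \<Longrightarrow>
      (rho has_real_derivative - rho t * (\<Sum>i=1..n. lam i t)) (at t within {0..<T})"
  shows "is_solution n k cb rho0 lam0 T lam rho"
proof -
  have c: "continuous_on {0..<T} rho" "\<And>i. i \<in> {1..n} \<Longrightarrow> continuous_on {0..<T} (lam i)"
    by (rule DERIV_continuous_on[OF rho], auto) (rule DERIV_continuous_on[OF lam], auto)
  show ?thesis
    unfolding is_solution_def using assms by (auto intro!: continuous_intros c)
qed

lemma is_solutionD:
  assumes "is_solution n k cb rho0 lam0 T lam rho"
  shows "0 < T" "rho 0 = rho0" "\<And>i. i \<in> {1..n} \<Longrightarrow> lam i 0 = lam0 i"
    and "\<And>t i. 0 \<le> t \<Longrightarrow> t < T \<Longrightarrow> i \<in> {1..n} \<Longrightarrow>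
      (lam i has_real_derivative - (lam i t)\<^sup>2 + k / real n * (rho t - cb)) (at t within {0..<T})"
    and "\<And>t. 0 \<le> t \<Longrightarrow> t < T \<Longrightarrow>
      (rho has_real_derivative - rho t * (\<Sum>i=1..n. lam i t)) (at t within {0..<T})"
  using assms unfolding is_solution_def by auto

text \<open>Bounded values give bounded derivatives, hence left limits at \<open>T\<close>. A local
  solution started at these limits, shifted by \<open>T\<close>, is glued to the given one; the
  derivatives match at \<open>T\<close> because the right-hand sides are continuous in the
  state.\<close>

lemma bounded_solution_extends:
  assumes sol: "is_solution n k cb rho0 lam0 T lam rho" and kc: "k \<ge> 0" "cb \<ge> 0"
    and bl: "\<And>t i. 0 \<le> t \<Longrightarrow> t < T \<Longrightarrow> i \<in> {1..n} \<Longrightarrow> \<bar>lam i t\<bar> \<le> B"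
    and br: "\<And>t. 0 \<le> t \<Longrightarrow> t < T \<Longrightarrow> \<bar>rho t\<bar> \<le> B"
  shows "\<exists>T' > T. \<exists>lam' rho'. is_solution n k cb rho0 lam0 T' lam' rho' \<and>
          (\<forall>t\<in>{0..<T}. rho' t = rho t \<and> (\<forall>i\<in>{1..n}. lam' i t = lam i t))"
proof -
  note D = is_solutionD[OF sol]
  define a where "a = k / real n"
  have a: "a \<ge> 0" using kc by (simp add: a_def)
  have B: "B \<ge> 0" using br[of 0] D(1) by auto
  have "\<exists>L. (lam i \<longlongrightarrow> L) (at_left T)" if i: "i \<in> {1..n}" for i
  proof -
    have "\<bar>- (lam i t)\<^sup>2 + k / real n * (rho t - cb)\<bar> \<le> B\<^sup>2 + a * (B + cb)" if "0 \<le> t" "t < T" for t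
    proof -
      have "(lam i t)\<^sup>2 \<le> B\<^sup>2"
        using power_mono[OF bl[OF that i], of 2] by simp
      moreover have "\<bar>a * (rho t - cb)\<bar> \<le> a * (B + cb)"
        unfolding abs_mult using br[OF that] kc a by (intro mult_mono) auto
      ultimately show ?thesis unfolding a_def[symmetric]
        using abs_triangle_ineq[of "- (lam i t)\<^sup>2" "a * (rho t - cb)"] by auto
    qed
    from bounded_deriv_tendsto_left[OF D(4)[OF _ _ i] this D(1)] show ?thesis by blast
  qed
  then obtain l where l: "\<And>i. i \<in> {1..n} \<Longrightarrow> (lam i \<longlongrightarrow> l i) (at_left T)" by metis
  have "\<bar>- rho t * (\<Sum>i=1..n. lam i t)\<bar> \<le> B * (real n * B)" if t: "0 \<le> t" "t < T" for t
  proof -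
    have "\<bar>\<Sum>i=1..n. lam i t\<bar> \<le> (\<Sum>i=1..n. B)"
      by (rule order.trans[OF sum_abs], rule sum_mono) (use bl t in auto)
    then show ?thesis unfolding abs_mult using br[OF t] B by (intro mult_mono) auto
  qed
  from bounded_deriv_tendsto_left[OF D(5) this D(1)]
  obtain r where r: "(rho \<longlongrightarrow> r) (at_left T)" by blast
  obtain h rho1 lam1 where h: "h > 0" "rho1 0 = r" "\<And>i. i \<in> {1..n} \<Longrightarrow> lam1 i 0 = l i"
    "\<And>t i. \<bar>t\<bar> < h \<Longrightarrow> i \<in> {1..n} \<Longrightarrow>
      (lam1 i has_real_derivative - (lam1 i t)\<^sup>2 + a * (rho1 t - cb)) (at t)"
    "\<And>t. \<bar>t\<bar> < h \<Longrightarrow> (rho1 has_real_derivative - rho1 t * (\<Sum>i=1..n. lam1 i t)) (at t)"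
    using local_solution_exists[OF a kc(2), of r n l] by blast
  define lam' where "lam' = (\<lambda>i t. if t < T then lam i t else lam1 i (t - T))"
  define rho' where "rho' = (\<lambda>t. if t < T then rho t else rho1 (t - T))"
  have "is_solution n k cb rho0 lam0 (T + h) lam' rho'"
  proof (rule is_solutionI)
    fix t i assume t: "0 \<le> t" "t < T + h" and i: "i \<in> {1..n}"
    have "(lam' i has_real_derivative
       (if t < T then - (lam i t)\<^sup>2 + k / real n * (rho t - cb)
        else - (lam1 i (t - T))\<^sup>2 + a * (rho1 (t - T) - cb))) (at t within {0..<T+h})"
      unfolding lam'_def
    proof (rule has_real_derivative_glue)
      fix t assume t: "T \<le> t" "t < T + h"
      then show "((\<lambda>t. lam1 i (t - T)) has_real_derivative - (lam1 i (t - T))\<^sup>2 + a * (rho1 (t - T) - cb)) (at t)"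
        using DERIV_shift[of "lam1 i" _ t "- T"] h(4)[of "t - T" i] i by auto
    qed (use D h t i in \<open>auto simp: a_def intro!: tendsto_eq_intros l r\<close>)
    then show "(lam' i has_real_derivative - (lam' i t)\<^sup>2 + k / real n * (rho' t - cb)) (at t within {0..<T+h})"
      by (auto simp: lam'_def rho'_def a_def split: if_splits)
  next
    fix t assume t: "0 \<le> t" "t < T + h"
    have "(rho' has_real_derivative
       (if t < T then - rho t * (\<Sum>i=1..n. lam i t)
        else - rho1 (t - T) * (\<Sum>i=1..n. lam1 i (t - T)))) (at t within {0..<T+h})"
      unfolding rho'_def
    proof (rule has_real_derivative_glue)
      fix t assume t: "T \<le> t" "t < T + h"
      then show "((\<lambda>t. rho1 (t - T)) has_real_derivative - rho1 (t - T) * (\<Sum>i=1..n. lam1 i (t - T))) (at t)"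
        using DERIV_shift[of rho1 _ t "- T"] h(5)[of "t - T"] by auto
    qed (use D h t in \<open>auto intro!: tendsto_eq_intros l r\<close>)
    then show "(rho' has_real_derivative - rho' t * (\<Sum>i=1..n. lam' i t)) (at t within {0..<T+h})"
      by (auto simp: lam'_def rho'_def split: if_splits)
  qed (use D h in \<open>auto simp: lam'_def rho'_def\<close>)
  then show ?thesis using h(1) by (intro exI[of _ "T + h"] conjI exI[of _ lam'] exI[of _ rho']) (auto simp: lam'_def rho'_def)
qed

section \<open>Riccati inequalities and logarithmic blow-up\<close>

lemma has_real_derivative_integral_Ico:
  fixes f :: "real \<Rightarrow> real"
  assumes "continuous_on {0..<T} f" "0 \<le> t" "t < T"
  shows "((\<lambda>t. integral {0..t} f) has_real_derivative f t) (at t within {0..<T})"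
proof -
  define b where "b = (t + T) / 2"
  have b: "t < b" "b < T" using assms by (auto simp: b_def)
  have "((\<lambda>t. integral {0..t} f) has_real_derivative f t) (at t within {0..b})"
    by (rule integral_has_real_derivative) (use assms b in \<open>auto intro: continuous_on_subset\<close>)
  moreover have "at t within {0..b} = at t within {0..<T}"
    by (rule at_within_nhd[of _ "{..<b}"]) (use b in auto)
  ultimately show ?thesis by simp
qed

text \<open>The derivative of \<open>arctan (u / w)\<close> is at least \<open>- w\<close>, so this
  bounded angle converges after a linear correction. Its limit lies in the closed interval from
  \<open>- pi/2\<close> to \<open>pi/2\<close>; the two end points and the interior give the three
  alternatives.\<close>

lemma riccati_trichotomy:
  fixes u u' :: "real \<Rightarrow> real"
  assumes T: "0 < T" and w: "0 < w"
    and der: "\<And>t. 0 \<le> t \<Longrightarrow> t < T \<Longrightarrow> (u has_real_derivative u' t) (at t within {0..<T})"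
    and ge: "\<And>t. 0 \<le> t \<Longrightarrow> t < T \<Longrightarrow> - (u t)\<^sup>2 - w\<^sup>2 \<le> u' t"
  obtains "filterlim u at_bot (at_left T)" | "filterlim u at_top (at_left T)"
    | l where "(u \<longlongrightarrow> l) (at_left T)"
proof -
  define \<theta> where "\<theta> = (\<lambda>t. arctan (u t / w))"
  have u: "u = (\<lambda>t. w * tan (\<theta> t))"
    using w by (auto simp: \<theta>_def tan_arctan)
  have up: "\<theta> s + w * s \<le> \<theta> t + w * t" if "0 \<le> s" "s \<le> t" "t < T" for s t
  proof (rule nondecreasing_if_deriv_nonneg[of 0 T "\<lambda>t. \<theta> t + w * t" "\<lambda>t. (u' t / w) / (1 + (u t / w)\<^sup>2) + w"])
    fix t assume t: "0 \<le> t" "t < T"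
    show "((\<lambda>t. \<theta> t + w * t) has_real_derivative (u' t / w) / (1 + (u t / w)\<^sup>2) + w) (at t within {0..<T})"
      unfolding \<theta>_def using w by (auto intro!: derivative_eq_intros der t simp: field_simps)
    define q where "q = 1 + (u t / w)\<^sup>2"
    have q: "0 < q" unfolding q_def by (intro add_pos_nonneg) auto
    have "u' t / w + w * q = (u' t + w\<^sup>2 + (u t)\<^sup>2) / w"
      using w by (simp add: q_def field_simps power2_eq_square)
    then have "0 \<le> u' t / w + w * q" using ge[OF t] w by simp
    moreover have "(u' t / w) / q + w = (u' t / w + w * q) / q"
      using q by (simp add: add_divide_distrib)
    ultimately have "0 \<le> (u' t / w) / q + w" using q by simp
    then show "0 \<le> (u' t / w) / (1 + (u t / w)\<^sup>2) + w" by (simp add: q_def)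
  qed (use that in auto)
  have range: "- (pi/2) < \<theta> t \<and> \<theta> t < pi/2" for t
    using arctan_bounded[of "u t / w"] by (simp add: \<theta>_def)
  have "\<theta> t + w * t \<le> pi/2 + w * T" if "0 \<le> t" "t < T" for t
    using range[of t] that w by (intro add_mono mult_left_mono) auto
  from bounded_nondecreasing_tendsto_left[of 0 T "\<lambda>t. \<theta> t + w * t", OF up this T]
  obtain L where "((\<lambda>t. \<theta> t + w * t) \<longlongrightarrow> L) (at_left T)" by blast
  then have "((\<lambda>t. (\<theta> t + w * t) - w * t) \<longlongrightarrow> L - w * T) (at_left T)"
    by (intro tendsto_intros)
  then obtain l where l: "(\<theta> \<longlongrightarrow> l) (at_left T)" by auto
  have "- (pi/2) \<le> l" "l \<le> pi/2"
    using tendsto_lowerbound[OF l, of "- (pi/2)"] tendsto_upperbound[OF l, of "pi/2"] range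
    by (auto simp: less_imp_le)
  then consider "l = - (pi/2)" | "l = pi/2" | "- (pi/2) < l" "l < pi/2" by linarith
  then show thesis
  proof cases
    case 1
    \<comment> \<open>The angle never attains the end point, so the limit is approached from inside,
      where \<open>tan\<close> diverges.\<close>
    have "filterlim \<theta> (at_right (- (pi/2))) (at_left T)"
      unfolding filterlim_at using l 1 range by (auto intro!: always_eventually) (metis less_irrefl)
    then have "filterlim (\<lambda>t. w * tan (\<theta> t)) at_bot (at_left T)"
      by (intro filterlim_tendsto_pos_mult_at_bot[OF tendsto_const w]
            filterlim_compose[OF filterlim_tan_at_right])
    then show thesis using that(1) u by simp
  next
    case 2
    have "filterlim \<theta> (at_left (pi/2)) (at_left T)"
      unfolding filterlim_at using l 2 range by (auto intro!: always_eventually) (metis less_irrefl)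
    then have "filterlim (\<lambda>t. w * tan (\<theta> t)) at_top (at_left T)"
      by (intro filterlim_tendsto_pos_mult_at_top[OF tendsto_const w]
            filterlim_compose[OF filterlim_tan_at_left])
    then show thesis using that(2) u by simp
  next
    case 3
    have "cos l \<noteq> 0" using cos_gt_zero_pi[of l] 3 by simp
    then have "((\<lambda>t. w * tan (\<theta> t)) \<longlongrightarrow> w * tan l) (at_left T)"
      by (intro tendsto_intros l)
    then show thesis using that(3) u by simp
  qed
qed

text \<open>Integrating the lower bound shows that \<open>f t + C * ln (T - t) + D * t\<close> is
  nondecreasing, and the logarithm diverges at \<open>T\<close>.\<close>

lemma unbounded_if_deriv_ge_inverse_distance:
  fixes f f' :: "real \<Rightarrow> real"
  assumes "0 \<le> t0" "t0 < T" and C: "0 < C"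
    and der: "\<And>t. t0 \<le> t \<Longrightarrow> t < T \<Longrightarrow> (f has_real_derivative f' t) (at t within {0..<T})"
    and ge: "\<And>t. t0 \<le> t \<Longrightarrow> t < T \<Longrightarrow> C / (T - t) - D \<le> f' t"
  shows "\<exists>t. t0 \<le> t \<and> t < T \<and> B < f t"
proof -
  let ?g = "\<lambda>t. f t + C * ln (T - t) + D * t"
  define K where "K = ?g t0"
  \<comment> \<open>\<open>N\<close> is chosen so that \<open>ln (T - t) \<le> - N\<close> forces
    \<open>f t\<close> to be at least \<open>B + 1\<close>; the minimum in \<open>t\<close> keeps
    the point to the right of \<open>t0\<close>.\<close>
  define N where "N = (B + \<bar>D\<bar> * T - K + 1) / C"
  define t where "t = T - min (T - t0) (exp (- N))"
  have t: "t0 \<le> t" "t < T" using assms by (auto simp: t_def)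
  have "?g t0 \<le> ?g t"
  proof (rule nondecreasing_if_deriv_nonneg[of t0 T ?g "\<lambda>t. f' t - C / (T - t) + D"])
    fix s assume s: "t0 \<le> s" "s < T"
    show "(?g has_real_derivative f' s - C / (T - s) + D) (at s within {0..<T})"
      using s by (auto intro!: derivative_eq_intros der simp: field_simps)
    show "0 \<le> f' s - C / (T - s) + D" using ge[OF s] by simp
  qed (use assms t in auto)
  moreover have "ln (T - t) \<le> - N"
  proof -
    have "T - t \<le> exp (- N)" by (simp add: t_def)
    then have "ln (T - t) \<le> ln (exp (- N))" using t by (subst ln_le_cancel_iff) auto
    then show ?thesis by simp
  qed
  then have "C * ln (T - t) \<le> C * (- N)" using C by (intro mult_left_mono) auto
  moreover have "C * N = B + \<bar>D\<bar> * T - K + 1" using C by (simp add: N_def)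
  moreover have "D * t \<le> \<bar>D\<bar> * T" using t assms by (intro mult_mono) auto
  ultimately have "B < f t" by (simp add: K_def)
  then show ?thesis using t by blast
qed

lemma tendsto_imp_bounded_Ico:
  fixes f :: "real \<Rightarrow> real"
  assumes "continuous_on {0..<T} f" "0 < T" "(f \<longlongrightarrow> l) (at_left T)"
  obtains B where "\<And>t. 0 \<le> t \<Longrightarrow> t < T \<Longrightarrow> \<bar>f t\<bar> \<le> B"
proof -
  have "eventually (\<lambda>t. dist (f t) l < 1) (at_left T)"
    using assms(3) by (rule tendstoD) simp
  then obtain b where b: "0 \<le> b" "b < T" "\<And>t. b \<le> t \<Longrightarrow> t < T \<Longrightarrow> dist (f t) l < 1"
    using at_left_Ico_obtain[OF _ assms(2)] by blast
  have "bounded (f ` {0..b})"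
    by (intro compact_imp_bounded compact_continuous_image continuous_on_subset[OF assms(1)])
      (use b in auto)
  then obtain B where "\<forall>t\<in>{0..b}. \<bar>f t\<bar> \<le> B"
    by (auto simp: bounded_iff)
  then have B: "\<bar>f t\<bar> \<le> B" if "0 \<le> t" "t \<le> b" for t
    using that by auto
  show thesis
  proof (rule that[of "max B (\<bar>l\<bar> + 1)"])
    fix t assume "0 \<le> t" "t < T"
    then show "\<bar>f t\<bar> \<le> max B (\<bar>l\<bar> + 1)"
      using B[of t] b(3)[of t] by (cases "t \<le> b") (auto simp: dist_real_def)
  qed
qed

lemma at_top_imp_bounded_below_Ico:
  fixes f :: "real \<Rightarrow> real"
  assumes "continuous_on {0..<T} f" "0 < T" "filterlim f at_top (at_left T)"
  obtains B where "\<And>t. 0 \<le> t \<Longrightarrow> t < T \<Longrightarrow> - B \<le> f t"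
proof -
  have "eventually (\<lambda>t. 0 \<le> f t) (at_left T)"
    using assms(3) by (auto simp: filterlim_at_top)
  then obtain b where b: "0 \<le> b" "b < T" "\<And>t. b \<le> t \<Longrightarrow> t < T \<Longrightarrow> 0 \<le> f t"
    using at_left_Ico_obtain[OF _ assms(2)] by blast
  have "bounded (f ` {0..b})"
    by (intro compact_imp_bounded compact_continuous_image continuous_on_subset[OF assms(1)])
      (use b in auto)
  then obtain B where "\<forall>t\<in>{0..b}. \<bar>f t\<bar> \<le> B"
    by (auto simp: bounded_iff)
  then have B: "\<bar>f t\<bar> \<le> B" if "0 \<le> t" "t \<le> b" for t
    using that by auto
  have "B \<ge> 0" using B[of 0] b by auto
  show thesis
  proof (rule that[of B])
    fix t assume "0 \<le> t" "t < T"
    then show "- B \<le> f t"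
      using B[of t] b(3)[of t] \<open>B \<ge> 0\<close> by (cases "t \<le> b") auto
  qed
qed

section \<open>Behaviour at the end of the interval of existence\<close>

text \<open>Consequences of the equations on \<open>{0..<T}\<close> alone, with \<open>a\<close> for
  \<open>k / n\<close>. Maximality enters only in the final proof.\<close>

locale flow =
  fixes n :: nat and a cb T :: real and lam :: "nat \<Rightarrow> real \<Rightarrow> real" and rho :: "real \<Rightarrow> real"
  assumes a: "0 < a" and cb: "0 < cb" and T: "0 < T" and rho0: "0 < rho 0"
    and dlam: "\<And>t i. 0 \<le> t \<Longrightarrow> t < T \<Longrightarrow> i \<in> {1..n} \<Longrightarrow>
      (lam i has_real_derivative - (lam i t)\<^sup>2 + a * (rho t - cb)) (at t within {0..<T})"
    and drho: "\<And>t. 0 \<le> t \<Longrightarrow> t < T \<Longrightarrow>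
      (rho has_real_derivative - rho t * (\<Sum>i=1..n. lam i t)) (at t within {0..<T})"
begin

section \<open>Linearising variables and conserved quantities\<close>

definition Y :: "nat \<Rightarrow> real \<Rightarrow> real" where
  "Y i t = exp (integral {0..t} (lam i))"

lemma Y_pos: "0 < Y i t"
  by (simp add: Y_def)

lemma Y_0: "Y i 0 = 1"
  by (simp add: Y_def)

lemma continuous_lam: "i \<in> {1..n} \<Longrightarrow> continuous_on {0..<T} (lam i)"
  by (rule DERIV_continuous_on[OF dlam]) auto

lemma dY:
  assumes "0 \<le> t" "t < T" "i \<in> {1..n}"
  shows "(Y i has_real_derivative lam i t * Y i t) (at t within {0..<T})"
  unfolding Y_def
  using has_real_derivative_integral_Ico[OF continuous_lam[OF assms(3)] assms(1,2)]
  by (auto intro!: derivative_eq_intros)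

text \<open>The logarithmic derivative of the product is the sum of all \<open>lam i\<close>, which
  cancels that of \<open>rho\<close>.\<close>

lemma rho_prod_Y:
  assumes "0 \<le> t" "t < T"
  shows "rho t * (\<Prod>i=1..n. Y i t) = rho 0"
proof -
  have "((\<lambda>t. rho t * (\<Prod>i=1..n. Y i t)) has_real_derivative 0) (at t within {0..<T})"
    if t: "0 \<le> t" "t < T" for t
  proof -
    have "((\<lambda>t. \<Prod>i=1..n. Y i t) has_real_derivative
        (\<Sum>i=1..n. (lam i t * Y i t) * (\<Prod>j\<in>{1..n} - {i}. Y j t))) (at t within {0..<T})"
      unfolding has_field_derivative_def
      by (rule has_derivative_eq_rhs[OF has_derivative_prod[where f' = "\<lambda>i. (*) (lam i t * Y i t)"]])
        (use dY[OF t] in \<open>auto intro!: ext simp: has_field_derivative_def sum_distrib_left mult_ac\<close>)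
    also have "(\<Sum>i=1..n. (lam i t * Y i t) * (\<Prod>j\<in>{1..n} - {i}. Y j t))
        = (\<Sum>i=1..n. lam i t) * (\<Prod>i=1..n. Y i t)"
      by (simp only: sum_distrib_right, rule sum.cong) (simp_all add: prod.remove)
    finally have 1: "((\<lambda>t. \<Prod>i=1..n. Y i t) has_real_derivative
        (\<Sum>i=1..n. lam i t) * (\<Prod>i=1..n. Y i t)) (at t within {0..<T})" .
    show ?thesis
      by (rule derivative_eq_intros drho[OF t] 1)+ (simp add: algebra_simps)
  qed
  from constant_if_deriv_zero[of T, OF this assms] show ?thesis by (simp add: Y_0)
qed

lemma rho_pos:
  assumes "0 \<le> t" "t < T"
  shows "0 < rho t"
proof -
  have "0 < (\<Prod>i=1..n. Y i t)" by (intro prod_pos) (auto simp: Y_pos)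
  then show ?thesis using rho_prod_Y[OF assms] rho0 by (metis zero_less_mult_pos2)
qed

text \<open>The forcing term is common to all indices, so the difference satisfies
  \<open>(lam j - lam i)' = - (lam j + lam i) * (lam j - lam i)\<close>, and
  \<open>Y i * Y j\<close> is its integrating factor.\<close>

lemma wronskian:
  assumes "i \<in> {1..n}" "j \<in> {1..n}" "0 \<le> t" "t < T"
  shows "(lam j t - lam i t) * (Y i t * Y j t) = lam j 0 - lam i 0"
proof -
  have "((\<lambda>t. (lam j t - lam i t) * (Y i t * Y j t)) has_real_derivative 0) (at t within {0..<T})"
    if t: "0 \<le> t" "t < T" for t
    by (rule derivative_eq_intros dlam dY t assms(1,2) refl)+ (simp add: algebra_simps power2_eq_square)
  from constant_if_deriv_zero[of T, OF this assms(3,4)] show ?thesis by (simp add: Y_0)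
qed

lemma lam_mono:
  assumes "i \<in> {1..n}" "j \<in> {1..n}" "0 \<le> t" "t < T" "lam i 0 \<le> lam j 0"
  shows "lam i t \<le> lam j t"
proof -
  have "0 < Y i t * Y j t" by (simp add: Y_pos)
  then show ?thesis using wronskian[OF assms(1-4)] assms(5)
    by (metis diff_ge_0_iff_ge zero_le_mult_iff not_less)
qed

text \<open>Positivity of \<open>rho\<close> bounds the forcing below by \<open>- a * cb\<close>,
  the square of the frequency \<open>w\<close> with a minus sign.\<close>

lemma lam_trichotomy:
  assumes "i \<in> {1..n}"
  obtains "filterlim (lam i) at_bot (at_left T)" | "filterlim (lam i) at_top (at_left T)"
    | l where "(lam i \<longlongrightarrow> l) (at_left T)"
proof (rule riccati_trichotomy[OF T, of "sqrt (a * cb)" "lam i" "\<lambda>t. - (lam i t)\<^sup>2 + a * (rho t - cb)"])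
  fix t assume t: "0 \<le> t" "t < T"
  show "- (lam i t)\<^sup>2 - (sqrt (a * cb))\<^sup>2 \<le> - (lam i t)\<^sup>2 + a * (rho t - cb)"
    using a cb rho_pos[OF t] by (simp add: algebra_simps)
qed (use a cb dlam assms that in auto)

section \<open>A priori bounds\<close>

text \<open>\<open>Y i t * exp (\<bar>B\<bar> * t)\<close> is nondecreasing. With the absolute
  value, \<open>exp (- \<bar>B\<bar> * t)\<close> is smallest at \<open>T\<close>, which makes the
  bound uniform.\<close>

lemma Y_ge_exp:
  assumes i: "i \<in> {1..n}" and B: "\<And>t. 0 \<le> t \<Longrightarrow> t < T \<Longrightarrow> - B \<le> lam i t" and t: "0 \<le> t" "t < T"
  shows "exp (- \<bar>B\<bar> * T) \<le> Y i t"
proof -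
  have "Y i 0 * exp (\<bar>B\<bar> * 0) \<le> Y i t * exp (\<bar>B\<bar> * t)"
  proof (rule nondecreasing_if_deriv_nonneg[of 0 T "\<lambda>t. Y i t * exp (\<bar>B\<bar> * t)"
        "\<lambda>t. (lam i t + \<bar>B\<bar>) * (Y i t * exp (\<bar>B\<bar> * t))"])
    fix s assume s: "0 \<le> s" "s < T"
    show "((\<lambda>t. Y i t * exp (\<bar>B\<bar> * t)) has_real_derivative (lam i s + \<bar>B\<bar>) * (Y i s * exp (\<bar>B\<bar> * s)))
        (at s within {0..<T})"
      by (rule derivative_eq_intros dY s i refl)+ (simp add: algebra_simps)
    show "0 \<le> (lam i s + \<bar>B\<bar>) * (Y i s * exp (\<bar>B\<bar> * s))"
      using B[OF s] Y_pos[of i s] by (intro mult_nonneg_nonneg) auto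
  qed (use t in auto)
  then have "exp (- \<bar>B\<bar> * t) \<le> Y i t"
    by (simp add: Y_0 exp_minus field_simps)
  moreover have "exp (- \<bar>B\<bar> * T) \<le> exp (- \<bar>B\<bar> * t)"
    using t by (simp add: mult_left_mono)
  ultimately show ?thesis by (rule order_trans[rotated])
qed

text \<open>Both remaining alternatives bound \<open>lam i\<close> below, hence \<open>Y i\<close>
  away from \<open>0\<close>; the conserved product then bounds \<open>rho\<close> by some
  \<open>r\<close>. Now \<open>lam i' \<le> a * r\<close> bounds \<open>lam i\<close> above, so
  divergence to plus infinity is excluded too.\<close>

lemma bounded_if_none_at_bot:
  assumes "\<And>i. i \<in> {1..n} \<Longrightarrow> \<not> filterlim (lam i) at_bot (at_left T)"
  obtains B where "\<And>t i. 0 \<le> t \<Longrightarrow> t < T \<Longrightarrow> i \<in> {1..n} \<Longrightarrow> \<bar>lam i t\<bar> \<le> B"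
    "\<And>t. 0 \<le> t \<Longrightarrow> t < T \<Longrightarrow> \<bar>rho t\<bar> \<le> B"
proof -
  have "\<exists>B. \<forall>t. 0 \<le> t \<longrightarrow> t < T \<longrightarrow> - B \<le> lam i t" if i: "i \<in> {1..n}" for i
  proof (rule lam_trichotomy[OF i])
    show ?thesis if "filterlim (lam i) at_bot (at_left T)" using that assms i by blast
    show ?thesis if "filterlim (lam i) at_top (at_left T)"
      using at_top_imp_bounded_below_Ico[OF continuous_lam[OF i] T that] by blast
    show ?thesis if l: "(lam i \<longlongrightarrow> l) (at_left T)" for l
    proof -
      obtain B where "\<And>t. 0 \<le> t \<Longrightarrow> t < T \<Longrightarrow> \<bar>lam i t\<bar> \<le> B"
        using tendsto_imp_bounded_Ico[OF continuous_lam[OF i] T l] by blast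
      then show ?thesis by (intro exI[of _ B]) (auto simp: abs_le_iff minus_le_iff)
    qed
  qed
  then obtain b where b: "\<And>i t. i \<in> {1..n} \<Longrightarrow> 0 \<le> t \<Longrightarrow> t < T \<Longrightarrow> - b i \<le> lam i t"
    by metis
  define p where "p = (\<Prod>i=1..n. exp (- \<bar>b i\<bar> * T))"
  define r where "r = rho 0 / p"
  have p: "0 < p" unfolding p_def by (intro prod_pos) auto
  have r: "rho t \<le> r" if t: "0 \<le> t" "t < T" for t
  proof -
    have "p \<le> (\<Prod>i=1..n. Y i t)"
      unfolding p_def by (intro prod_mono conjI Y_ge_exp b t) auto
    then have "rho t * p \<le> rho 0"
      using rho_prod_Y[OF t] rho_pos[OF t] by (metis less_imp_le mult_left_mono)
    then show ?thesis using p by (simp add: r_def field_simps)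
  qed
  have up: "lam i t \<le> lam i 0 + a * r * T" if i: "i \<in> {1..n}" and t: "0 \<le> t" "t < T" for i t
  proof -
    have "lam i t - a * r * t \<le> lam i 0 - a * r * 0"
    proof (rule nonincreasing_if_deriv_nonpos[of 0 T "\<lambda>t. lam i t - a * r * t"
          "\<lambda>t. - (lam i t)\<^sup>2 + a * (rho t - cb) - a * r"])
      fix s assume s: "0 \<le> s" "s < T"
      show "((\<lambda>t. lam i t - a * r * t) has_real_derivative - (lam i s)\<^sup>2 + a * (rho s - cb) - a * r)
        (at s within {0..<T})"
        by (rule derivative_eq_intros dlam s i refl)+ simp
      have "a * (rho s - cb) \<le> a * r" using r[OF s] a cb by (intro mult_left_mono) auto
      then show "- (lam i s)\<^sup>2 + a * (rho s - cb) - a * r \<le> 0"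
        using zero_le_power2[of "lam i s"] by linarith
    qed (use t in auto)
    moreover have "a * r * t \<le> a * r * T"
      using t a p rho0 by (intro mult_left_mono) (auto simp: r_def)
    ultimately show ?thesis by simp
  qed
  define B where "B = (\<Sum>i=1..n. \<bar>b i\<bar> + \<bar>lam i 0 + a * r * T\<bar>) + r"
  have r0: "0 \<le> r" using p rho0 by (simp add: r_def)
  show thesis
  proof (rule that[of B])
    fix t i assume t: "0 \<le> t" "t < T" and i: "i \<in> {1..n}"
    have "\<bar>lam i t\<bar> \<le> \<bar>b i\<bar> + \<bar>lam i 0 + a * r * T\<bar>"
      using up[OF i t] b[OF i t] by linarith
    also have "\<dots> \<le> (\<Sum>i=1..n. \<bar>b i\<bar> + \<bar>lam i 0 + a * r * T\<bar>)"
      by (rule member_le_sum[OF i]) auto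
    finally show "\<bar>lam i t\<bar> \<le> B" using r0 by (simp add: B_def)
  next
    fix t assume t: "0 \<le> t" "t < T"
    have "0 \<le> (\<Sum>i=1..n. \<bar>b i\<bar> + \<bar>lam i 0 + a * r * T\<bar>)" by (intro sum_nonneg) auto
    then show "\<bar>rho t\<bar> \<le> B" using r[OF t] rho_pos[OF t] by (simp add: B_def)
  qed
qed

section \<open>Indices tending to minus infinity\<close>

text \<open>Once \<open>lam i\<close> is negative, \<open>Y i\<close> no longer increases, so the
  derivative \<open>a * (rho - cb) * Y i\<close> of the flux \<open>lam i * Y i\<close> is bounded
  below. As the flux is the derivative of \<open>Y i\<close>, its lower bound \<open>- M\<close>
  gives the linear decay.\<close>

lemma Y_decay_if_at_bot:
  assumes i: "i \<in> {1..n}" and bot: "filterlim (lam i) at_bot (at_left T)"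
  obtains t0 M where "0 \<le> t0" "t0 < T" "0 < M"
    "\<And>t. t0 \<le> t \<Longrightarrow> t < T \<Longrightarrow> lam i t < 0"
    "\<And>t. t0 \<le> t \<Longrightarrow> t < T \<Longrightarrow> - M \<le> lam i t * Y i t"
    "\<And>t. t0 \<le> t \<Longrightarrow> t < T \<Longrightarrow> Y i t \<le> M * (T - t)"
    "\<And>t. t0 \<le> t \<Longrightarrow> t < T \<Longrightarrow> Y i t \<le> M"
    "(Y i \<longlongrightarrow> 0) (at_left T)"
proof -
  have "eventually (\<lambda>t. lam i t < 0) (at_left T)"
    using bot by (auto simp: filterlim_at_bot_dense)
  then obtain t0 where t0: "0 \<le> t0" "t0 < T" and neg: "\<And>t. t0 \<le> t \<Longrightarrow> t < T \<Longrightarrow> lam i t < 0"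
    using at_left_Ico_obtain[OF _ T] by blast
  define A where "A = Y i t0"
  have A: "Y i t \<le> A" if "t0 \<le> t" "t < T" for t
    unfolding A_def
  proof (rule nonincreasing_if_deriv_nonpos[of t0 T "Y i" "\<lambda>t. lam i t * Y i t"])
    fix s assume s: "t0 \<le> s" "s < T"
    show "lam i s * Y i s \<le> 0" using neg[OF s] Y_pos[of i s] by (simp add: mult_le_0_iff)
  qed (use dY i t0 that in auto)
  define D where "D = a * cb * A"
  have D: "0 < D" using a cb Y_pos[of i t0] by (simp add: D_def A_def)
  \<comment> \<open>The first two terms bound the flux, the summand \<open>A\<close> makes
    \<open>M\<close> a bound for \<open>Y i\<close> as well.\<close>
  define M where "M = \<bar>lam i t0 * Y i t0\<bar> + D * T + A"
  have M: "0 < M" "A \<le> M" using D T Y_pos[of i t0] by (auto simp: M_def A_def intro!: add_nonneg_pos)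
  have flux: "- M \<le> lam i t * Y i t" if t: "t0 \<le> t" "t < T" for t
  proof -
    have "lam i t0 * Y i t0 + D * t0 \<le> lam i t * Y i t + D * t"
    proof (rule nondecreasing_if_deriv_nonneg[of t0 T "\<lambda>t. lam i t * Y i t + D * t"
          "\<lambda>t. a * (rho t - cb) * Y i t + D"])
      fix s assume s: "t0 \<le> s" "s < T"
      have s': "0 \<le> s" using s t0 by simp
      show "((\<lambda>t. lam i t * Y i t + D * t) has_real_derivative a * (rho s - cb) * Y i s + D) (at s within {0..<T})"
        by (rule derivative_eq_intros dlam dY s' s(2) i refl)+ (simp add: algebra_simps power2_eq_square)
      have "0 \<le> a * rho s * Y i s"
        using a rho_pos[of s] Y_pos[of i s] s t0 by auto
      moreover have "a * cb * Y i s \<le> D"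
        unfolding D_def using a cb A[OF s] by (intro mult_left_mono) auto
      ultimately show "0 \<le> a * (rho s - cb) * Y i s + D"
        by (simp add: algebra_simps)
    qed (use t0 t in auto)
    moreover have "D * t \<le> D * T" "0 \<le> D * t0" using D t t0 by auto
    ultimately show ?thesis using Y_pos[of i t0] by (simp add: M_def A_def)
  qed
  have lim: "(Y i \<longlongrightarrow> 0) (at_left T)"
  \<comment> \<open>Dividing the flux bound by the negative \<open>lam i t\<close> turns it into an
    upper bound for \<open>Y i t\<close> that tends to \<open>0\<close>.\<close>
  proof (rule tendsto_sandwich[of "\<lambda>_. 0" _ _ "\<lambda>t. - M * inverse (lam i t)"])
    show "eventually (\<lambda>t. Y i t \<le> - M * inverse (lam i t)) (at_left T)"
      by (rule at_left_Ico[OF t0(2)]) (use flux neg in \<open>auto simp: field_simps\<close>)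
    have "((\<lambda>t. inverse (lam i t)) \<longlongrightarrow> 0) (at_left T)"
      by (rule tendsto_inverse_0[THEN filterlim_compose])
        (use bot filterlim_mono[OF bot at_bot_le_at_infinity order_refl] in auto)
    then show "((\<lambda>t. - M * inverse (lam i t)) \<longlongrightarrow> 0) (at_left T)"
      using tendsto_mult_right_zero by blast
  qed (auto simp: Y_pos less_imp_le)
  have "Y i t \<le> M * (T - t)" if t: "t0 \<le> t" "t < T" for t
  proof -
    \<comment> \<open>The flux bound is integrated from \<open>t\<close> to \<open>s\<close>;
      letting \<open>s\<close> tend to \<open>T\<close>, where \<open>Y i\<close> vanishes in the
      limit, leaves \<open>M * (T - t)\<close>.\<close>
    have "Y i t + M * t \<le> Y i s + M * s" if "t \<le> s" "s < T" for s
    proof (rule nondecreasing_if_deriv_nonneg[of t0 T "\<lambda>t. Y i t + M * t" "\<lambda>t. lam i t * Y i t + M"])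
      fix s assume "t0 \<le> s" "s < T"
      then show "((\<lambda>t. Y i t + M * t) has_real_derivative lam i s * Y i s + M) (at s within {0..<T})"
        using t0 by (auto intro!: derivative_eq_intros dY i)
    qed (use flux t0 t that in force)+
    then have "eventually (\<lambda>s. Y i t + M * t \<le> Y i s + M * s) (at_left T)"
      by (intro at_left_Ico[OF t(2)])
    moreover have "((\<lambda>s. Y i s + M * s) \<longlongrightarrow> 0 + M * T) (at_left T)"
      by (intro tendsto_intros lim)
    ultimately have "Y i t + M * t \<le> 0 + M * T"
      by (intro tendsto_lowerbound[where F = "at_left T"]) auto
    then show ?thesis by (simp add: algebra_simps)
  qed
  then show thesis using that[OF t0 M(1) neg flux _ _ lim] A M(2) by force
qed

text \<open>The conserved Wronskian is a difference of two products, each a bounded flux times a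
  \<open>Y\<close> tending to \<open>0\<close>. Being constant, it equals its limit
  \<open>0\<close>.\<close>

lemma at_bot_imp_same_initial:
  assumes i: "i \<in> {1..n}" and j: "j \<in> {1..n}"
    and "filterlim (lam i) at_bot (at_left T)" "filterlim (lam j) at_bot (at_left T)"
  shows "lam i 0 = lam j 0"
proof -
  obtain ti Mi where I: "0 \<le> ti" "ti < T" "0 < Mi"
    "\<And>t. ti \<le> t \<Longrightarrow> t < T \<Longrightarrow> lam i t < 0"
    "\<And>t. ti \<le> t \<Longrightarrow> t < T \<Longrightarrow> - Mi \<le> lam i t * Y i t" "(Y i \<longlongrightarrow> 0) (at_left T)"
    using Y_decay_if_at_bot[OF i assms(3)] by metis
  obtain tj Mj where J: "0 \<le> tj" "tj < T" "0 < Mj"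
    "\<And>t. tj \<le> t \<Longrightarrow> t < T \<Longrightarrow> lam j t < 0"
    "\<And>t. tj \<le> t \<Longrightarrow> t < T \<Longrightarrow> - Mj \<le> lam j t * Y j t" "(Y j \<longlongrightarrow> 0) (at_left T)"
    using Y_decay_if_at_bot[OF j assms(4)] by metis
  have "((\<lambda>t. (lam j t * Y j t) * Y i t - (lam i t * Y i t) * Y j t) \<longlongrightarrow> 0 - 0) (at_left T)"
  proof (intro tendsto_diff)
    show "((\<lambda>t. (lam j t * Y j t) * Y i t) \<longlongrightarrow> 0) (at_left T)"
    proof (rule Lim_null_comparison)
      show "eventually (\<lambda>t. norm ((lam j t * Y j t) * Y i t) \<le> Mj * Y i t) (at_left T)"
      proof (rule at_left_Ico[OF J(2)])
        fix t assume t: "tj \<le> t" "t < T"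
        have "\<bar>lam j t * Y j t\<bar> \<le> Mj"
          using J(5)[OF t] J(4)[OF t] Y_pos[of j t] mult_neg_pos[of "lam j t" "Y j t"] by auto
        then show "norm ((lam j t * Y j t) * Y i t) \<le> Mj * Y i t"
          using Y_pos[of i t] by (simp add: abs_mult mult_right_mono)
      qed
      show "((\<lambda>t. Mj * Y i t) \<longlongrightarrow> 0) (at_left T)" using I(6) tendsto_mult_right_zero by blast
    qed
    show "((\<lambda>t. (lam i t * Y i t) * Y j t) \<longlongrightarrow> 0) (at_left T)"
    proof (rule Lim_null_comparison)
      show "eventually (\<lambda>t. norm ((lam i t * Y i t) * Y j t) \<le> Mi * Y j t) (at_left T)"
      proof (rule at_left_Ico[OF I(2)])
        fix t assume t: "ti \<le> t" "t < T"
        have "\<bar>lam i t * Y i t\<bar> \<le> Mi"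
          using I(5)[OF t] I(4)[OF t] Y_pos[of i t] mult_neg_pos[of "lam i t" "Y i t"] by auto
        then show "norm ((lam i t * Y i t) * Y j t) \<le> Mi * Y j t"
          using Y_pos[of j t] by (simp add: abs_mult mult_right_mono)
      qed
      show "((\<lambda>t. Mi * Y j t) \<longlongrightarrow> 0) (at_left T)" using J(6) tendsto_mult_right_zero by blast
    qed
  qed
  moreover have "eventually (\<lambda>t. lam j t * Y j t * Y i t - lam i t * Y i t * Y j t = lam j 0 - lam i 0) (at_left T)"
    by (rule at_left_Ico[OF T]) (simp add: wronskian[OF i j, symmetric] algebra_simps)
  ultimately have "((\<lambda>t. lam j 0 - lam i 0) \<longlongrightarrow> 0) (at_left T)"
    using Lim_transform_eventually by fastforce
  then show ?thesis by (simp add: tendsto_const_iff)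
qed

section \<open>Exclusion of equal initial data and of finite limits\<close>

text \<open>One small factor controls the product when the others are bounded. Since
  \<open>1 \<le> A\<close>, the exponent may be \<open>n\<close> for every \<open>I\<close>, and a
  proper subset \<open>I\<close> allows one index to be left out.\<close>

lemma prod_Y_le:
  assumes "I \<subseteq> {1..n}" "i \<in> I" "1 \<le> A" "\<And>j. j \<in> I \<Longrightarrow> Y j t \<le> A" "Y i t \<le> d"
  shows "(\<Prod>j\<in>I. Y j t) \<le> d * A ^ n"
proof -
  have fin: "finite I" using assms(1) finite_subset by auto
  have "(\<Prod>j\<in>I. Y j t) = Y i t * (\<Prod>j\<in>I - {i}. Y j t)"
    using fin assms(2) by (simp add: prod.remove)
  also have "\<dots> \<le> d * (\<Prod>j\<in>I - {i}. A)"
    by (intro mult_mono prod_mono prod_nonneg conjI)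
      (use assms Y_pos in \<open>auto simp: less_imp_le intro: order_trans[OF less_imp_le[OF Y_pos]]\<close>)
  also have "\<dots> = d * A ^ card (I - {i})" by simp
  also have "\<dots> \<le> d * A ^ n"
  proof -
    have "card (I - {i}) \<le> n" using card_mono[OF _ assms(1)] card_Diff1_le[of I i] by simp
    then show ?thesis
      using assms(3,5) Y_pos[of i t] by (intro mult_left_mono power_increasing) auto
  qed
  finally show ?thesis .
qed

text \<open>With equal data all \<open>Y i\<close> coincide and decay linearly. Then
  \<open>rho * Y 1\<close> is \<open>rho 0\<close> divided by the remaining factors, so the flux
  \<open>lam 1 * Y 1\<close> has a derivative of order \<open>1 / (T - t)\<close> and becomes
  positive, against \<open>lam 1 < 0\<close>.\<close>

lemma not_all_equal_if_at_bot:
  assumes n: "2 \<le> n" and bot: "filterlim (lam 1) at_bot (at_left T)"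
  shows "\<exists>i\<in>{1..n}. lam i 0 \<noteq> lam 1 0"
proof (rule ccontr)
  assume "\<not> ?thesis"
  then have eq0: "lam i 0 = lam 1 0" if "i \<in> {1..n}" for i using that by blast
  have one: "1 \<in> {1..n}" using n by auto
  have Yeq: "Y i t = Y 1 t" if i: "i \<in> {1..n}" and t: "0 \<le> t" "t < T" for i t
  proof -
    have "lam i s = lam 1 s" if "0 \<le> s" "s \<le> t" for s
      using lam_mono[OF i one, of s] lam_mono[OF one i, of s] eq0[OF i] that t by auto
    then have "integral {0..t} (lam i) = integral {0..t} (lam 1)"
      by (intro integral_cong) auto
    then show ?thesis by (simp add: Y_def)
  qed
  obtain t0 M where D: "0 \<le> t0" "t0 < T" "0 < M"
    "\<And>t. t0 \<le> t \<Longrightarrow> t < T \<Longrightarrow> lam 1 t < 0"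
    "\<And>t. t0 \<le> t \<Longrightarrow> t < T \<Longrightarrow> Y 1 t \<le> M * (T - t)"
    "\<And>t. t0 \<le> t \<Longrightarrow> t < T \<Longrightarrow> Y 1 t \<le> M"
    using Y_decay_if_at_bot[OF one bot] by metis
  define A where "A = max 1 M"
  define C where "C = a * rho 0 / (M * A ^ n)"
  have A: "1 \<le> A" "M \<le> A" by (auto simp: A_def)
  have C: "0 < C" using a rho0 D(3) A by (simp add: C_def)
  have "\<exists>t. t0 \<le> t \<and> t < T \<and> 0 < lam 1 t * Y 1 t"
  proof (rule unbounded_if_deriv_ge_inverse_distance[OF D(1,2) C,
        of "\<lambda>t. lam 1 t * Y 1 t" "\<lambda>t. a * (rho t - cb) * Y 1 t" "a * cb * M"])
    fix t assume t: "t0 \<le> t" "t < T"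
    have t': "0 \<le> t" using t D(1) by simp
    show "((\<lambda>t. lam 1 t * Y 1 t) has_real_derivative a * (rho t - cb) * Y 1 t) (at t within {0..<T})"
      by (rule derivative_eq_intros dlam dY t' t(2) one refl)+ (simp add: algebra_simps power2_eq_square)
    \<comment> \<open>The weight \<open>Y 1\<close> in the derivative of the flux uses up the factor
      with index \<open>1\<close>; \<open>2 \<le> n\<close> ensures that a decaying factor, the one
      with index \<open>2\<close>, remains.\<close>
    let ?P = "\<Prod>j\<in>{2..n}. Y j t"
    have P: "?P \<le> M * (T - t) * A ^ n"
    proof (rule prod_Y_le[of _ 2])
      fix j assume "j \<in> {2..n}"
      then show "Y j t \<le> A" using Yeq[of j t] D(6)[OF t] t t' A by auto
    qed (use n t t' D(5) A Yeq[of 2 t] in auto)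
    have P0: "0 < ?P" by (intro prod_pos) (auto simp: Y_pos)
    have "{1..n} = insert 1 {2..n}" using n by auto
    then have "rho t * Y 1 t * ?P = rho 0"
      using rho_prod_Y[OF t' t(2)] by (simp add: mult.assoc)
    then have "a * rho t * Y 1 t = a * rho 0 / ?P"
      using P0 by (intro eq_divide_imp) (simp_all only: mult.assoc less_irrefl less_imp_neq[symmetric] not_False_eq_True)
    also have "\<dots> \<ge> a * rho 0 / (M * (T - t) * A ^ n)"
      using P P0 a rho0 by (intro divide_left_mono) (auto intro!: mult_pos_pos)
    also have "a * rho 0 / (M * (T - t) * A ^ n) = C / (T - t)" by (simp add: C_def)
    finally have "C / (T - t) \<le> a * rho t * Y 1 t" .
    moreover have "a * cb * Y 1 t \<le> a * cb * M"
      using a cb D(6)[OF t] by (intro mult_left_mono) auto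
    ultimately show "C / (T - t) - a * cb * M \<le> a * (rho t - cb) * Y 1 t"
      by (simp add: algebra_simps)
  qed
  then obtain t where "t0 \<le> t" "t < T" "0 < lam 1 t * Y 1 t" by blast
  then show False using D(4)[of t] Y_pos[of 1 t] by (simp add: zero_less_mult_iff)
qed

text \<open>A finite limit bounds \<open>lam j\<close>, hence \<open>Y j\<close> from both sides,
  and through the Wronskians every \<open>Y m\<close> from above. As \<open>Y i\<close> decays
  linearly, \<open>rho\<close> is at least of order \<open>1 / (T - t)\<close>, which drives
  \<open>lam j\<close> beyond its bound.\<close>

lemma no_finite_limit_if_at_bot:
  assumes i: "i \<in> {1..n}" and bot: "filterlim (lam i) at_bot (at_left T)"
    and j: "j \<in> {1..n}" and l: "(lam j \<longlongrightarrow> l) (at_left T)"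
  shows False
proof -
  obtain B where B: "\<And>t. 0 \<le> t \<Longrightarrow> t < T \<Longrightarrow> \<bar>lam j t\<bar> \<le> B"
    using tendsto_imp_bounded_Ico[OF continuous_lam[OF j] T l] by blast
  define y where "y = exp (- \<bar>B\<bar> * T)"
  have y: "0 < y" by (simp add: y_def)
  have Yj: "y \<le> Y j t" if "0 \<le> t" "t < T" for t
    unfolding y_def by (rule Y_ge_exp[OF j _ that]) (use B in \<open>auto simp: abs_le_iff minus_le_iff\<close>)
  have Yj_up: "Y j t \<le> exp (B * T)" if t: "0 \<le> t" "t < T" for t
  proof -
    have "Y j t * exp (- B * t) \<le> Y j 0 * exp (- B * 0)"
    proof (rule nonincreasing_if_deriv_nonpos[of 0 T "\<lambda>t. Y j t * exp (- B * t)"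
          "\<lambda>t. (lam j t - B) * (Y j t * exp (- B * t))"])
      fix s assume s: "0 \<le> s" "s < T"
      show "((\<lambda>t. Y j t * exp (- B * t)) has_real_derivative (lam j s - B) * (Y j s * exp (- B * s)))
          (at s within {0..<T})"
        by (rule derivative_eq_intros dY s j refl)+ (simp add: algebra_simps)
      show "(lam j s - B) * (Y j s * exp (- B * s)) \<le> 0"
        using B[OF s] Y_pos[of j s] by (intro mult_nonpos_nonneg) auto
    qed (use t in auto)
    then have "Y j t \<le> exp (B * t)" by (simp add: Y_0 exp_minus field_simps)
    also have "\<dots> \<le> exp (B * T)" using t B[OF t] by (auto intro!: mult_left_mono)
    finally show ?thesis .
  qed
  \<comment> \<open>The derivative of \<open>Y m / Y j\<close> is the constant Wronskian divided by
    the square of \<open>Y j\<close>, so \<open>c m\<close> bounds it on the whole interval.\<close>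
  define c where "c = (\<lambda>m. \<bar>lam m 0 - lam j 0\<bar> / y\<^sup>2)"
  have ratio: "Y m t \<le> (1 + c m * T) * exp (B * T)" if m: "m \<in> {1..n}" and t: "0 \<le> t" "t < T" for m t
  proof -
    have "Y m t / Y j t - c m * t \<le> Y m 0 / Y j 0 - c m * 0"
    proof (rule nonincreasing_if_deriv_nonpos[of 0 T "\<lambda>t. Y m t / Y j t - c m * t"
          "\<lambda>t. (lam m 0 - lam j 0) / (Y j t)\<^sup>2 - c m"])
      fix s assume s: "0 \<le> s" "s < T"
      have "((\<lambda>t. Y m t / Y j t - c m * t) has_real_derivative
          (lam m s - lam j s) * (Y j s * Y m s) / (Y j s)\<^sup>2 - c m) (at s within {0..<T})"
        using Y_pos[of j s]
        by (auto intro!: derivative_eq_intros dY s j m simp: field_simps power2_eq_square)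
      then show "((\<lambda>t. Y m t / Y j t - c m * t) has_real_derivative
          (lam m 0 - lam j 0) / (Y j s)\<^sup>2 - c m) (at s within {0..<T})"
        by (simp add: wronskian[OF j m s])
      have "(lam m 0 - lam j 0) / (Y j s)\<^sup>2 \<le> \<bar>lam m 0 - lam j 0\<bar> / (Y j s)\<^sup>2"
        by (intro divide_right_mono) auto
      also have "\<dots> \<le> c m"
        unfolding c_def using Yj[OF s] y by (intro divide_left_mono power_mono) auto
      finally show "(lam m 0 - lam j 0) / (Y j s)\<^sup>2 - c m \<le> 0" by simp
    qed (use t in auto)
    then have "Y m t \<le> (1 + c m * t) * Y j t"
      using Y_pos[of j t] by (simp add: Y_0 field_simps)
    also have "\<dots> \<le> (1 + c m * T) * exp (B * T)"
      using t Yj_up[OF t] Y_pos[of j t] y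
      by (intro mult_mono add_left_mono mult_left_mono) (auto simp: c_def intro!: add_nonneg_nonneg)
    finally show ?thesis .
  qed
  define A where "A = 1 + (\<Sum>m=1..n. (1 + c m * T) * exp (B * T))"
  have c0: "0 \<le> (1 + c m * T) * exp (B * T)" for m
    using T by (auto simp: c_def intro!: add_nonneg_nonneg)
  have A: "1 \<le> A" using c0 by (simp add: A_def sum_nonneg)
  have YA: "Y m t \<le> A" if m: "m \<in> {1..n}" and t: "0 \<le> t" "t < T" for m t
    using ratio[OF m t] member_le_sum[OF m, of "\<lambda>m. (1 + c m * T) * exp (B * T)"] c0
    by (simp add: A_def)
  obtain t0 M where D: "0 \<le> t0" "t0 < T" "0 < M"
    "\<And>t. t0 \<le> t \<Longrightarrow> t < T \<Longrightarrow> Y i t \<le> M * (T - t)"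
    using Y_decay_if_at_bot[OF i bot] by metis
  define C where "C = a * rho 0 / (M * A ^ n)"
  have C: "0 < C" using a rho0 D(3) A by (simp add: C_def)
  have "\<exists>t. t0 \<le> t \<and> t < T \<and> B < lam j t"
  proof (rule unbounded_if_deriv_ge_inverse_distance[OF D(1,2) C,
        of "lam j" "\<lambda>t. - (lam j t)\<^sup>2 + a * (rho t - cb)" "B\<^sup>2 + a * cb"])
    fix t assume t: "t0 \<le> t" "t < T"
    then have t': "0 \<le> t" using D(1) by simp
    show "(lam j has_real_derivative - (lam j t)\<^sup>2 + a * (rho t - cb)) (at t within {0..<T})"
      by (rule dlam[OF t' t(2) j])
    let ?P = "\<Prod>m\<in>{1..n}. Y m t"
    have P: "?P \<le> M * (T - t) * A ^ n"
      by (rule prod_Y_le[of _ i]) (use i t t' D A YA in auto)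
    have P0: "0 < ?P" by (intro prod_pos) (auto simp: Y_pos)
    have "a * rho t = a * rho 0 / ?P"
      using P0 rho_prod_Y[OF t' t(2)] by (intro eq_divide_imp) (simp_all only: mult.assoc less_irrefl less_imp_neq[symmetric] not_False_eq_True)
    also have "\<dots> \<ge> a * rho 0 / (M * (T - t) * A ^ n)"
      using P P0 a rho0 by (intro divide_left_mono) (auto intro!: mult_pos_pos)
    also have "a * rho 0 / (M * (T - t) * A ^ n) = C / (T - t)" by (simp add: C_def)
    finally have "C / (T - t) \<le> a * rho t" .
    moreover have "(lam j t)\<^sup>2 \<le> B\<^sup>2"
      using power_mono[OF B[OF t' t(2)], of 2] by simp
    ultimately show "C / (T - t) - (B\<^sup>2 + a * cb) \<le> - (lam j t)\<^sup>2 + a * (rho t - cb)"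
      by (simp add: algebra_simps)
  qed
  then obtain t where t: "t0 \<le> t" "t < T" "B < lam j t" by blast
  then show False using B[of t] D(1) by auto
qed

end

section \<open>Alternatives at the blow-up time for ordered initial data\<close>

theorem theorem3p2:
  fixes n J :: nat and k cb rho0 tB :: real
    and lam0 :: "nat \<Rightarrow> real" and lam :: "nat \<Rightarrow> real \<Rightarrow> real" and rho :: "real \<Rightarrow> real"
  assumes "n \<ge> 2" and "k > 0" and "cb > 0" and "rho0 > 0"
    and "1 \<le> J" and "J \<le> n"
    and "\<forall>i\<in>{1..J}. lam0 i = lam0 1"
    and "J < n \<longrightarrow> lam0 J < lam0 (J + 1)"
    and "\<forall>i. J < i \<and> i < n \<longrightarrow> lam0 i \<le> lam0 (i + 1)"
    and "0 < tB"
    and "maximal_solution n k cb rho0 lam0 tB lam rho"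
  shows "J < n
    \<and> (\<forall>i\<in>{1..J}. filterlim (lam i) at_bot (at_left tB))
    \<and> (\<forall>i\<in>{J<..n}. filterlim (lam i) at_top (at_left tB))"
proof -
  have sol: "is_solution n k cb rho0 lam0 tB lam rho"
    using assms(11) by (simp add: maximal_solution_def)
  note D = is_solutionD[OF sol]
  interpret flow n "k / real n" cb tB lam rho
  proof
    show "0 < k / real n" using assms(1,2) by simp
    show "0 < rho 0" using D(2) assms(4) by simp
  qed (fact assms D)+
  have one: "1 \<in> {1..n}" using assms(1) by auto
  have low: "lam i 0 = lam 1 0" if "i \<in> {1..J}" for i
  proof -
    have "lam0 i = lam0 1" using assms(7) that by blast
    moreover have "i \<in> {1..n}" using that assms(6) by auto
    ultimately show ?thesis using D(3) one by metis
  qed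
  \<comment> \<open>Induction on the distance \<open>d\<close> from \<open>J + 1\<close>: the strict
    gap after \<open>J\<close> is carried upwards by the weak inequalities.\<close>
  have step: "lam0 1 < lam0 (J + 1 + d)" if "J + 1 + d \<le> n" for d
    using that
  proof (induction d)
    case 0
    have "lam0 J = lam0 1" using assms(5) by (intro assms(7)[rule_format]) simp
    then show ?case using assms(8)[rule_format] 0 by (metis Suc_eq_plus1 Suc_le_lessD add_0_right)
  next
    case (Suc d)
    then have "lam0 (J + 1 + d) \<le> lam0 (J + 1 + d + 1)" by (intro assms(9)[rule_format]) auto
    then show ?case using Suc by simp
  qed
  have high: "lam 1 0 < lam i 0" if "i \<in> {J<..n}" for i
    using step[of "i - J - 1"] that D(3) one by auto
  have min: "lam 1 0 \<le> lam i 0" if "i \<in> {1..n}" for i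
    using low[of i] high[of i] that by (cases "i \<le> J") auto
  \<comment> \<open>Maximality is used here: otherwise the solution is bounded and can be continued
    beyond \<open>tB\<close>.\<close>
  have "\<exists>i\<in>{1..n}. filterlim (lam i) at_bot (at_left tB)"
  proof (rule ccontr)
    assume "\<not> ?thesis"
    then obtain B where "\<And>t i. 0 \<le> t \<Longrightarrow> t < tB \<Longrightarrow> i \<in> {1..n} \<Longrightarrow> \<bar>lam i t\<bar> \<le> B"
      "\<And>t. 0 \<le> t \<Longrightarrow> t < tB \<Longrightarrow> \<bar>rho t\<bar> \<le> B"
      using bounded_if_none_at_bot by blast
    from bounded_solution_extends[OF sol _ _ this] assms(2,3,11)
    show False by (simp add: maximal_solution_def)
  qed
  then obtain p where p: "p \<in> {1..n}" "filterlim (lam p) at_bot (at_left tB)" by blast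
  have le_bot: "filterlim (lam i) at_bot (at_left tB)"
    if "i \<in> {1..n}" "j \<in> {1..n}" "lam i 0 \<le> lam j 0" "filterlim (lam j) at_bot (at_left tB)" for i j
    using that(4)
    by (rule filterlim_at_bot_mono) (rule at_left_Ico[OF T], use lam_mono that in auto)
  \<comment> \<open>The index \<open>p\<close> is arbitrary, but \<open>lam 1\<close> starts lowest,
    stays below \<open>lam p\<close> and is dragged down with it.\<close>
  have bot1: "filterlim (lam 1) at_bot (at_left tB)"
    by (rule le_bot[OF one p(1) min[OF p(1)] p(2)])
  have "J < n"
  proof (rule ccontr)
    assume "\<not> J < n"
    then have "J = n" using assms(6) by simp
    then show False using not_all_equal_if_at_bot[OF assms(1) bot1] low by blast
  qed
  moreover have "filterlim (lam i) at_bot (at_left tB)" if i: "i \<in> {1..J}" for i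
  proof (rule le_bot[OF _ one _ bot1])
    show "i \<in> {1..n}" using i assms(6) by auto
    show "lam i 0 \<le> lam 1 0" by (rule eq_refl[OF low[OF i]])
  qed
  moreover have "filterlim (lam i) at_top (at_left tB)" if i: "i \<in> {J<..n}" for i
  proof -
    have i': "i \<in> {1..n}" using i by auto
    show ?thesis
    proof (rule lam_trichotomy[OF i'])
      assume "filterlim (lam i) at_bot (at_left tB)"
      from at_bot_imp_same_initial[OF one i' bot1 this] high[OF i] show ?thesis by simp
    next
      fix l assume "(lam i \<longlongrightarrow> l) (at_left tB)"
      from no_finite_limit_if_at_bot[OF one bot1 i' this] show ?thesis ..
    qed
  qed
  ultimately show ?thesis by blast
qed

end
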